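(* Let $A$ be a commutative ring. If $M\subseteq A$ is an idempotent minimal ideal (that is, $M$ is minimal among the non-zero ideals of $A$ and $M^2=M$), then $M$ is coprime.
   Context: All rings are commutative with identity. For ideals $I,J$ of a ring $A$, $\operatorname{Ann}(I)=\{a\in A\mid aI=0\}$ and $(J:I)=\{a\in A\mid aI\subseteq J\}$. The coproduct of $I$ and $J$ is the ideal $[I:J]:=(J:\operatorname{Ann}(I))=\{a\in A\mid a\operatorname{Ann}(I)\subseteq J\}$. An ideal $C$ of $A$ is coprime if $C\neq 0$ and, for all ideals $I,J$ of $A$, $C\subseteq [I:J]$ implies $C\subseteq I$ or $C\subseteq J$. *)

theory Defs
  imports "HOL-Algebra.Ideal_Product"
begin

text \<open>
  The operations below are defined for arbitrary sets and are meant to be applied to ideals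
  of a commutative ring. For an ideal \<open>I\<close>, the set \<open>aI\<close> of multiples \<open>ax\<close> with \<open>x\<close> in \<open>I\<close>
  is the left translate \<open>a <#\<^bsub>R\<^esub> I\<close> in the multiplicative monoid of \<open>R\<close>.
\<close>

definition annihilator :: "('a, 'b) ring_scheme \<Rightarrow> 'a set \<Rightarrow> 'a set"
  where "annihilator R I = {a \<in> carrier R. a <#\<^bsub>R\<^esub> I = {\<zero>\<^bsub>R\<^esub>}}"

text \<open>\<open>ideal_quotient R J I\<close> is the colon ideal \<open>(J : I)\<close>.\<close>

definition ideal_quotient :: "('a, 'b) ring_scheme \<Rightarrow> 'a set \<Rightarrow> 'a set \<Rightarrow> 'a set"
  where "ideal_quotient R J I = {a \<in> carrier R. a <#\<^bsub>R\<^esub> I \<subseteq> J}"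

text \<open>\<open>ideal_coproduct R I J\<close> is the coproduct \<open>[I : J]\<close>.\<close>

definition ideal_coproduct :: "('a, 'b) ring_scheme \<Rightarrow> 'a set \<Rightarrow> 'a set \<Rightarrow> 'a set"
  where "ideal_coproduct R I J = ideal_quotient R J (annihilator R I)"

definition coprime_ideal :: "('a, 'b) ring_scheme \<Rightarrow> 'a set \<Rightarrow> bool"
  where "coprime_ideal R C \<longleftrightarrow>
    ideal C R \<and> C \<noteq> {\<zero>\<^bsub>R\<^esub>} \<and>
    (\<forall>I J. ideal I R \<longrightarrow> ideal J R \<longrightarrow> C \<subseteq> ideal_coproduct R I J \<longrightarrow> C \<subseteq> I \<or> C \<subseteq> J)"

definition minimal_ideal :: "('a, 'b) ring_scheme \<Rightarrow> 'a set \<Rightarrow> bool"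
  where "minimal_ideal R M \<longleftrightarrow>
    ideal M R \<and> M \<noteq> {\<zero>\<^bsub>R\<^esub>} \<and>
    (\<forall>I. ideal I R \<longrightarrow> I \<noteq> {\<zero>\<^bsub>R\<^esub>} \<longrightarrow> I \<subseteq> M \<longrightarrow> I = M)"

end

theory Submission
  imports Defs
begin

text \<open>
  By minimality \<open>M \<inter> I\<close> is \<open>M\<close> or zero. In the second case \<open>MI \<subseteq> M \<inter> I = 0\<close>, so \<open>M\<close>
  annihilates \<open>I\<close>, and \<open>M \<subseteq> [I : J]\<close> gives \<open>M = M\<^sup>2 \<subseteq> J\<close>.
\<close>

text \<open>The product ideal is generated inductively from the products
  \<open>i \<otimes> j\<close> by addition alone, and \<open>K\<close> is closed under
  addition.\<close>

lemma (in ring) ideal_prod_subsetI: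
  assumes "ideal K R" and "\<And>i j. i \<in> I \<Longrightarrow> j \<in> J \<Longrightarrow> i \<otimes> j \<in> K"
  shows "I \<cdot> J \<subseteq> K"
proof
  fix s assume "s \<in> I \<cdot> J"
  then show "s \<in> K"
    by (induction s rule: ideal_prod.induct)
      (simp_all add: assms(2) additive_subgroup.a_closed[OF ideal.axioms(1)[OF assms(1)]])
qed

text \<open>Both ideals absorb a product of their elements, so it lies in the zero
  intersection.\<close>

lemma (in cring) ideal_subset_annihilator:
  assumes I: "ideal I R" and J: "ideal J R" and "I \<inter> J = {\<zero>}"
  shows "I \<subseteq> annihilator R J"
proof
  fix a assume a: "a \<in> I"
  have aR: "a \<in> carrier R"
    using a by (rule ideal.Icarr[OF I])
  have "a \<otimes> x = \<zero>" if x: "x \<in> J" for x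
  proof -
    have "a \<otimes> x \<in> I \<inter> J"
      using ideal.I_r_closed[OF I a ideal.Icarr[OF J x]] ideal.I_l_closed[OF J x aR] by blast
    then show ?thesis
      using assms(3) by blast
  qed
  \<comment> \<open>\<open>annihilator\<close> demands that \<open>a <# J\<close> equal the zero
    set, so \<open>J\<close> must be nonempty.\<close>
  moreover have "\<zero> \<in> J"
    using J by (simp add: ideal.axioms(1) additive_subgroup.zero_closed)
  ultimately have "a <# J = {\<zero>}"
    unfolding l_coset_def by auto
  then show "a \<in> annihilator R J"
    using aR by (simp add: annihilator_def)
qed

theorem proposition10:
  fixes A :: "('a, 'b) ring_scheme" and M :: "'a set"
  assumes "cring A"
    and "minimal_ideal A M"
    and "M \<cdot>\<^bsub>A\<^esub> M = M"
  shows "coprime_ideal A M"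
proof -
  interpret cring A by fact
  have M: "ideal M A" "M \<noteq> {\<zero>\<^bsub>A\<^esub>}"
    and minimal: "\<And>I. ideal I A \<Longrightarrow> I \<noteq> {\<zero>\<^bsub>A\<^esub>} \<Longrightarrow> I \<subseteq> M \<Longrightarrow> I = M"
    using assms(2) by (auto simp: minimal_ideal_def)
  have "M \<subseteq> J"
    if I: "ideal I A" and J: "ideal J A" and sub: "M \<subseteq> ideal_coproduct A I J" and "\<not> M \<subseteq> I"
    for I J
  proof -
    have "M \<inter> I = {\<zero>\<^bsub>A\<^esub>}"
      using minimal[OF i_intersect[OF M(1) I]] \<open>\<not> M \<subseteq> I\<close> by blast
    then have "M \<subseteq> annihilator A I"
      by (rule ideal_subset_annihilator[OF M(1) I])
    \<comment> \<open>The two factors play different roles: \<open>x\<close> is taken in the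
      coproduct of \<open>I\<close> and \<open>J\<close>, \<open>y\<close> in the annihilator of
      \<open>I\<close>.\<close>
    then have "x \<otimes>\<^bsub>A\<^esub> y \<in> J" if "x \<in> M" "y \<in> M" for x y
      using sub that unfolding ideal_coproduct_def ideal_quotient_def l_coset_def by blast
    then have "M \<cdot>\<^bsub>A\<^esub> M \<subseteq> J"
      by (rule ideal_prod_subsetI[OF J])
    then show ?thesis
      using assms(3) by simp
  qed
  then show ?thesis
    using M unfolding coprime_ideal_def by blast
qed

end
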